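(* Let $E$ be a Banach space, let $S_{\mathcal A}:[0,\infty)\to\mathcal L(E)$ be strongly continuous and locally bounded with $S_{\mathcal A}(0)=I$, let $P_{\mathcal A}\in L^1((0,T);\mathcal L(E))$ for every $T>0$, and let $\mathcal N:E\to E$ be Lipschitz on bounded sets. For every $u_0\in E$ there is $T_*>0$ for which the mild equation $$u(t)=S_{\mathcal A}(t)u_0+\int_0^tP_{\mathcal A}(t-s)\,\mathcal N(u(s))\,ds$$ has a unique solution $u\in C([0,T_*];E)$. Moreover, two mild solutions with the same initial value coincide on every common interval of existence.
   Context: $\mathcal L(E)$ is the space of bounded linear operators on $E$ with the operator norm. "Lipschitz on bounded sets" means: for every $R>0$ there is $L_R$ such that $\|\mathcal N(u)-\mathcal N(v)\|_E\le L_R\|u-v\|_E$ whenever $\|u\|_E,\|v\|_E\le R$. A mild solution on an interval $[0,T]$ (or $[0,T)$) with initial value $u_0$ is a continuous $E$-valued function on that interval satisfying the displayed equation for every $t$ in it. *)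

theory Defs
  imports "HOL-Analysis.Analysis"
begin

text \<open>
  The library's \<^const>\<open>integrable\<close> and \<^const>\<open>lebesgue_integral\<close> require a second-countable
  codomain. Neither a general Banach space nor its operator space need be separable, so strong
  (Bochner) measurability and the Bochner integral are defined here for all normed spaces,
  reusing the library's integral of simple functions, which has no such restriction.
\<close>

definition strongly_measurable :: "'a measure \<Rightarrow> ('a \<Rightarrow> 'b::real_normed_vector) \<Rightarrow> bool" where
  "strongly_measurable M f \<longleftrightarrow>
     (\<exists>s. (\<forall>i::nat. simple_function M (s i)) \<and> (AE x in M. (\<lambda>i. s i x) \<longlonglongrightarrow> f x))"

definition bochner_integrable :: "'a measure \<Rightarrow> ('a \<Rightarrow> 'b::real_normed_vector) \<Rightarrow> bool" where
  "bochner_integrable M f \<longleftrightarrow>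
     strongly_measurable M f \<and> (\<integral>\<^sup>+ x. ennreal (norm (f x)) \<partial>M) < \<infinity>"

definition is_bochner_integral ::
    "'a measure \<Rightarrow> ('a \<Rightarrow> 'b::real_normed_vector) \<Rightarrow> 'b \<Rightarrow> bool" where
  "is_bochner_integral M f x \<longleftrightarrow>
     strongly_measurable M f \<and>
     (\<exists>s. (\<forall>i::nat. Bochner_Integration.simple_bochner_integrable M (s i)) \<and>
          (\<lambda>i. \<integral>\<^sup>+ y. ennreal (norm (f y - s i y)) \<partial>M) \<longlonglongrightarrow> 0 \<and>
          (\<lambda>i. Bochner_Integration.simple_bochner_integral M (s i)) \<longlonglongrightarrow> x)"

text \<open>Meaningful only when \<^term>\<open>bochner_integrable M f\<close> and the codomain is complete.\<close>

definition bochner_integral :: "'a measure \<Rightarrow> ('a \<Rightarrow> 'b::real_normed_vector) \<Rightarrow> 'b" where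
  "bochner_integral M f = (THE x. is_bochner_integral M f x)"

definition lipschitz_on_bounded_sets :: "('a::real_normed_vector \<Rightarrow> 'a) \<Rightarrow> bool" where
  "lipschitz_on_bounded_sets N \<longleftrightarrow> (\<forall>R>0. \<exists>L. L-lipschitz_on (cball 0 R) N)"

text \<open>The third case is \<open>[0,T)\<close> with \<open>T = \<infinity>\<close>.\<close>

definition existence_interval :: "real set \<Rightarrow> bool" where
  "existence_interval J \<longleftrightarrow> (\<exists>T>0. J = {0..T} \<or> J = {0..<T}) \<or> J = {0..}"

text \<open>
  Functions on \<open>J\<close> are represented by total functions whose values off \<open>J\<close> are irrelevant, and
  likewise \<open>S\<close> and \<open>P\<close> matter only on \<open>[0,\<infinity>)\<close> and \<open>(0,\<infinity>)\<close>. The integrability conjunct says that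
  the integral in the mild equation is a genuine Bochner integral and not an unspecified value.
\<close>

definition mild_solution ::
    "(real \<Rightarrow> ('a::banach \<Rightarrow>\<^sub>L 'a)) \<Rightarrow> (real \<Rightarrow> ('a \<Rightarrow>\<^sub>L 'a)) \<Rightarrow> ('a \<Rightarrow> 'a) \<Rightarrow> 'a \<Rightarrow>
     real set \<Rightarrow> (real \<Rightarrow> 'a) \<Rightarrow> bool" where
  "mild_solution S P N u0 J u \<longleftrightarrow>
     existence_interval J \<and> continuous_on J u \<and>
     (\<forall>t\<in>J.
        bochner_integrable (lebesgue_on {0<..<t}) (\<lambda>s. blinfun_apply (P (t - s)) (N (u s))) \<and>
        u t = blinfun_apply (S t) u0
              + bochner_integral (lebesgue_on {0<..<t}) (\<lambda>s. blinfun_apply (P (t - s)) (N (u s))))"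

end

theory Submission
  imports Defs
begin

text \<open>
  After the substitution \<open>r = t - s\<close> the convolution term is \<open>\<integral>\<^sub>0\<^sup>t P(r) N(u(t - r)) dr\<close>. With
  \<open>m(t) = \<integral>\<^sub>0\<^sup>t \<parallel>P(r)\<parallel> dr\<close>, which is continuous with \<open>m(0) = 0\<close>, two continuous functions that agree
  on \<open>[0,a]\<close> have convolution terms at \<open>t\<close> differing by at most \<open>L m(t - a) sup \<parallel>u - v\<parallel>\<close>. For
  \<open>a = 0\<close> and a short interval this makes the right-hand side a contraction of a ball of continuous
  functions. For general \<open>a\<close> it propagates equality of two solutions from \<open>[0,a]\<close> to \<open>[0,a+d]\<close>,
  where the step \<open>d\<close> depends only on a common bound of the solutions.
\<close>

subsection \<open>Bochner integrals with non-separable codomain\<close>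

text \<open>Extending \<open>h\<close> by zero off \<open>S\<close> turns the integral over the
  restricted measure into one over the whole space, where nonnegative Lebesgue and gauge integrals
  agree. The next lemma goes the other way.\<close>

lemma nonneg_has_integral_lebesgue_on:
  fixes h :: "'a::euclidean_space \<Rightarrow> real"
  assumes S: "S \<in> sets lebesgue" and h: "h \<in> borel_measurable (lebesgue_on S)" "\<And>x. 0 \<le> h x"
    and r: "0 \<le> r" "(\<integral>\<^sup>+ x. ennreal (h x) \<partial>lebesgue_on S) = ennreal r"
  shows "(h has_integral r) S"
proof -
  let ?f = "\<lambda>x. if x \<in> S then h x else 0"
  have "?f \<in> borel_measurable lebesgue"
    using borel_measurable_if[OF S, of h] h(1) by simp
  moreover have "(\<integral>\<^sup>+ x. ennreal (?f x) \<partial>lebesgue) = (\<integral>\<^sup>+ x. ennreal (h x) * indicator S x \<partial>lebesgue)"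
    by (intro nn_integral_cong) (auto simp: indicator_def)
  moreover have "\<dots> = ennreal r"
    using S r(2) by (simp add: nn_integral_restrict_space del: nn_integral_completion)
  ultimately have "(?f has_integral r) UNIV"
    using h(2) r(1) by (subst has_integral_iff_nn_integral_lebesgue) auto
  then show ?thesis
    by (simp add: has_integral_restrict_UNIV)
qed

lemma nonneg_nn_integral_lebesgue_on:
  fixes h :: "'a::euclidean_space \<Rightarrow> real"
  assumes S: "S \<in> sets lebesgue" and h: "\<And>x. x \<in> S \<Longrightarrow> 0 \<le> h x" "h integrable_on S"
  shows "(\<integral>\<^sup>+ x. ennreal (h x) \<partial>lebesgue_on S) = ennreal (integral S h)"
proof -
  have "(\<integral>\<^sup>+ x. ennreal (h x) \<partial>lebesgue_on S) = (\<integral>\<^sup>+ x. ennreal (h x) * indicator S x \<partial>lebesgue)"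
    using S by (simp add: nn_integral_restrict_space del: nn_integral_completion)
  also have "\<dots> = ennreal (integral S h)"
    unfolding nn_integral_completion
    using h by (intro nn_integral_has_integral_lebesgue') (auto simp: integrable_integral)
  finally show ?thesis .
qed

text \<open>The function \<open>lim\<close> of the zero extensions is measurable whether or not the
  sequence converges at a point, and it equals \<open>f\<close> almost everywhere. Completeness of
  \<open>lebesgue\<close> then makes \<open>f\<close> itself measurable.\<close>

lemma borel_measurable_lebesgue_on_AE_LIMSEQ:
  fixes f :: "'a::euclidean_space \<Rightarrow> real"
  assumes S: "S \<in> sets lebesgue" and s: "\<And>i. s i \<in> borel_measurable (lebesgue_on S)"
    and lim: "AE x in lebesgue_on S. (\<lambda>i. s i x) \<longlonglongrightarrow> f x"
  shows "f \<in> borel_measurable (lebesgue_on S)"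
proof -
  let ?s = "\<lambda>i x. if x \<in> S then s i x else 0"
  let ?f = "\<lambda>x. if x \<in> S then f x else 0"
  have [measurable]: "?s i \<in> borel_measurable lebesgue" for i
    using borel_measurable_if[OF S, of "s i"] s by simp
  have "AE x in lebesgue. lim (\<lambda>i. ?s i x) = ?f x"
    using lim S by (auto simp: AE_restrict_space_iff elim!: eventually_mono intro!: limI)
  moreover have "(\<lambda>x. lim (\<lambda>i. ?s i x)) \<in> borel_measurable lebesgue"
    by measurable
  ultimately have "?f \<in> borel_measurable lebesgue"
    by (rule borel_measurable_AE[rotated])
  then show ?thesis
    using borel_measurable_if[OF S, of f] by simp
qed

section \<open>Simple approximation and existence of the Bochner integral\<close>

text \<open>The functions \<open>norm (s i x - r x)\<close> are real-valued and simple, so the limit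
  is taken among real functions and separability of the codomain never enters.\<close>

lemma strongly_measurable_norm_diff:
  fixes f :: "'a::euclidean_space \<Rightarrow> 'b::real_normed_vector"
  assumes S: "S \<in> sets lebesgue" and f: "strongly_measurable (lebesgue_on S) f"
    and r: "simple_function (lebesgue_on S) r"
  shows "(\<lambda>x. norm (f x - r x)) \<in> borel_measurable (lebesgue_on S)"
proof -
  obtain s where s: "\<And>i::nat. simple_function (lebesgue_on S) (s i)"
    and lim: "AE x in lebesgue_on S. (\<lambda>i. s i x) \<longlonglongrightarrow> f x"
    using f unfolding strongly_measurable_def by blast
  show ?thesis
  proof (rule borel_measurable_lebesgue_on_AE_LIMSEQ[OF S])
    show "(\<lambda>x. norm (s i x - r x)) \<in> borel_measurable (lebesgue_on S)" for i
      by (intro borel_measurable_simple_function simple_function_compose2[OF s r])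
    show "AE x in lebesgue_on S. (\<lambda>i. norm (s i x - r x)) \<longlonglongrightarrow> norm (f x - r x)"
      using lim by eventually_elim (intro tendsto_intros)
  qed
qed

lemmas strongly_measurable_norm =
  strongly_measurable_norm_diff[where r="\<lambda>_. 0", OF _ _ simple_function_const, simplified]

lemma bochner_integrable_norm_integrable_on:
  fixes f :: "'a::euclidean_space \<Rightarrow> 'b::real_normed_vector"
  assumes S: "S \<in> sets lebesgue" and f: "bochner_integrable (lebesgue_on S) f"
  shows "(\<lambda>x. norm (f x)) integrable_on S"
proof -
  have "(\<integral>\<^sup>+ x. ennreal (norm (f x)) \<partial>lebesgue_on S) < top"
    using f by (simp add: bochner_integrable_def)
  then obtain r where "0 \<le> r" "(\<integral>\<^sup>+ x. ennreal (norm (f x)) \<partial>lebesgue_on S) = ennreal r"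
    by (cases "\<integral>\<^sup>+ x. ennreal (norm (f x)) \<partial>lebesgue_on S") auto
  then show ?thesis
    using nonneg_has_integral_lebesgue_on[OF S strongly_measurable_norm[OF S]] f
    by (auto simp: bochner_integrable_def integrable_on_def)
qed

text \<open>The triangle inequality through \<open>f\<close> under the integral. It makes the
  integrals of an approximating sequence of simple functions Cauchy.\<close>

lemma norm_simple_bochner_integral_diff_le:
  fixes f :: "'a::euclidean_space \<Rightarrow> 'b::real_normed_vector"
  assumes S: "S \<in> sets lebesgue" and f: "strongly_measurable (lebesgue_on S) f"
    and s: "Bochner_Integration.simple_bochner_integrable (lebesgue_on S) s"
    and t: "Bochner_Integration.simple_bochner_integrable (lebesgue_on S) t"
  shows "ennreal (norm (Bochner_Integration.simple_bochner_integral (lebesgue_on S) s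
            - Bochner_Integration.simple_bochner_integral (lebesgue_on S) t))
         \<le> (\<integral>\<^sup>+ x. ennreal (norm (f x - s x)) \<partial>lebesgue_on S)
           + (\<integral>\<^sup>+ x. ennreal (norm (f x - t x)) \<partial>lebesgue_on S)"
    (is "ennreal (norm (?s - ?t)) \<le> ?S + ?T")
proof -
  let ?M = "lebesgue_on S"
  have ss: "simple_function ?M s" and tt: "simple_function ?M t"
    using s t by (auto elim: Bochner_Integration.simple_bochner_integrable.cases)
  have "ennreal (norm (?s - ?t))
      = norm (Bochner_Integration.simple_bochner_integral ?M (\<lambda>x. s x - t x))"
    using s t by (subst Bochner_Integration.simple_bochner_integral_diff) auto
  also have "\<dots> \<le> Bochner_Integration.simple_bochner_integral ?M (\<lambda>x. norm (s x - t x))"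
    using Bochner_Integration.simple_bochner_integrable_compose2[of "(-)" ?M s t] s t
    by (auto intro!: Bochner_Integration.simple_bochner_integral_norm_bound)
  also have "\<dots> = (\<integral>\<^sup>+ x. norm (s x - t x) \<partial>?M)"
    using Bochner_Integration.simple_bochner_integrable_compose2[of "\<lambda>x y. norm (x - y)" ?M s t] s t
    by (auto intro!: Bochner_Integration.simple_bochner_integral_eq_nn_integral)
  also have "\<dots> \<le> (\<integral>\<^sup>+ x. ennreal (norm (f x - s x)) + ennreal (norm (f x - t x)) \<partial>?M)"
  proof (rule nn_integral_mono)
    fix x
    have "norm (s x - t x) \<le> norm (f x - s x) + norm (f x - t x)"
      by (metis dual_order.refl norm_diff_triangle_le norm_minus_commute)
    then show "ennreal (norm (s x - t x)) \<le> ennreal (norm (f x - s x)) + ennreal (norm (f x - t x))"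
      by (metis ennreal_leI ennreal_plus norm_ge_zero)
  qed
  also have "\<dots> = ?S + ?T"
    using strongly_measurable_norm_diff[OF S f ss] strongly_measurable_norm_diff[OF S f tt]
    by (intro nn_integral_add) auto
  finally show ?thesis .
qed

lemma bochner_integrable_imp_simple_approximation:
  fixes f :: "'a::euclidean_space \<Rightarrow> 'b::real_normed_vector"
  assumes S: "S \<in> sets lebesgue" and f: "bochner_integrable (lebesgue_on S) f"
  obtains s where "\<And>i::nat. Bochner_Integration.simple_bochner_integrable (lebesgue_on S) (s i)"
    and "(\<lambda>i. \<integral>\<^sup>+ x. ennreal (norm (f x - s i x)) \<partial>lebesgue_on S) \<longlonglongrightarrow> 0"
proof -
  let ?M = "lebesgue_on S"
  have sm: "strongly_measurable ?M f" and fin: "(\<integral>\<^sup>+ x. ennreal (norm (f x)) \<partial>?M) < \<infinity>"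
    using f by (auto simp: bochner_integrable_def)
  note [measurable] = strongly_measurable_norm[OF S sm]
  obtain r where r: "\<And>i::nat. simple_function ?M (r i)"
    and lim: "AE x in ?M. (\<lambda>i. r i x) \<longlonglongrightarrow> f x"
    using sm unfolding strongly_measurable_def by blast
  \<comment> \<open>Truncation makes the sequence dominated by \<open>2 * norm (f x)\<close> and
    keeps its limit: where \<open>f x\<close> is nonzero, the factor 2 leaves room for
    \<open>r i x\<close> to survive eventually, and where \<open>f x = 0\<close> the truncated value
    is 0.\<close>
  define s where "s i x = (if norm (r i x) \<le> 2 * norm (f x) then r i x else 0)" for i x
  have r_norm [measurable]: "(\<lambda>x. norm (r i x)) \<in> borel_measurable ?M" for i
    by (intro borel_measurable_simple_function simple_function_compose1[OF r])
  have "{x \<in> space ?M. norm (r i x) \<le> 2 * norm (f x)} \<in> sets ?M" for i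
    by measurable
  then have s_simple: "simple_function ?M (s i)" for i
    unfolding s_def by (intro simple_function_If r simple_function_const) auto
  have s_bound: "norm (s i x) \<le> 2 * norm (f x)" for i x
    by (auto simp: s_def)
  have fin2: "(\<integral>\<^sup>+ x. ennreal (c * norm (f x)) \<partial>?M) < \<infinity>" if "0 \<le> c" for c
    using fin that by (simp add: ennreal_mult nn_integral_cmult ennreal_mult_less_top)
  have "Bochner_Integration.simple_bochner_integrable ?M (s i)" for i
  proof (rule Bochner_Integration.simple_bochner_integrableI_bounded[OF s_simple])
    show "(\<integral>\<^sup>+ x. ennreal (norm (s i x)) \<partial>?M) < \<infinity>"
      using s_bound by (intro le_less_trans[OF nn_integral_mono fin2[of 2]] ennreal_leI) auto
  qed
  moreover have s_lim: "AE x in ?M. (\<lambda>i. s i x) \<longlonglongrightarrow> f x"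
    using lim
  proof eventually_elim
    case (elim x)
    show ?case
    proof (cases "f x = 0")
      case True
      then have "s i x = 0" for i
        by (simp add: s_def)
      then show ?thesis
        using True by simp
    next
      case False
      then have "norm (f x) < 2 * norm (f x)"
        by simp
      then have "\<forall>\<^sub>F i in sequentially. norm (r i x) < 2 * norm (f x)"
        by (rule order_tendstoD(2)[OF tendsto_norm[OF elim]])
      then have "\<forall>\<^sub>F i in sequentially. r i x = s i x"
        by eventually_elim (simp add: s_def)
      then show ?thesis
        using elim by (rule Lim_transform_eventually[rotated])
    qed
  qed
  have "(\<lambda>i. \<integral>\<^sup>+ x. ennreal (norm (0 - norm (f x - s i x))) \<partial>?M) \<longlonglongrightarrow> 0"
  \<comment> \<open>The dominating factor 3 is 1 for \<open>f\<close> plus 2 for the truncated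
    \<open>s i\<close>.\<close>
  proof (rule nn_integral_dominated_convergence_norm[where w="\<lambda>x. 3 * norm (f x)"])
    show "(\<lambda>x. norm (f x - s i x)) \<in> borel_measurable ?M" for i
      by (rule strongly_measurable_norm_diff[OF S sm s_simple])
    show "AE x in ?M. norm (norm (f x - s i x)) \<le> 3 * norm (f x)" for i
    proof (rule AE_I2)
      fix x
      show "norm (norm (f x - s i x)) \<le> 3 * norm (f x)"
        using s_bound[of i x] norm_triangle_ineq4[of "f x" "s i x"] by simp
    qed
    show "AE x in ?M. (\<lambda>i. norm (f x - s i x)) \<longlonglongrightarrow> 0"
      using s_lim
    proof eventually_elim
      case (elim x)
      show ?case
        using tendsto_norm[OF tendsto_diff[OF tendsto_const[of "f x"] elim]] by simp
    qed
  qed (use fin2[of 3] in auto)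
  then have "(\<lambda>i. \<integral>\<^sup>+ x. ennreal (norm (f x - s i x)) \<partial>?M) \<longlonglongrightarrow> 0"
    by simp
  ultimately show thesis
    using that by blast
qed

lemma ex_is_bochner_integral:
  fixes f :: "'a::euclidean_space \<Rightarrow> 'b::banach"
  assumes S: "S \<in> sets lebesgue" and f: "bochner_integrable (lebesgue_on S) f"
  shows "\<exists>x. is_bochner_integral (lebesgue_on S) f x"
proof -
  let ?M = "lebesgue_on S"
  have sm: "strongly_measurable ?M f"
    using f by (auto simp: bochner_integrable_def)
  obtain s where s: "\<And>i::nat. Bochner_Integration.simple_bochner_integrable ?M (s i)"
    and lim: "(\<lambda>i. \<integral>\<^sup>+ x. ennreal (norm (f x - s i x)) \<partial>?M) \<longlonglongrightarrow> 0"
    using bochner_integrable_imp_simple_approximation[OF S f] by blast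
  let ?I = "\<lambda>i. Bochner_Integration.simple_bochner_integral ?M (s i)"
  have "Cauchy ?I"
  proof (rule CauchyI)
    fix e :: real assume e: "0 < e"
    then obtain n where n: "\<And>i. n \<le> i \<Longrightarrow> (\<integral>\<^sup>+ x. ennreal (norm (f x - s i x)) \<partial>?M) < ennreal (e / 2)"
      using order_tendstoD(2)[OF lim, of "ennreal (e / 2)"] by (auto simp: eventually_sequentially)
    have "norm (?I i - ?I j) < e" if ij: "n \<le> i" "n \<le> j" for i j
    proof -
      have "ennreal (norm (?I i - ?I j)) \<le> (\<integral>\<^sup>+ x. ennreal (norm (f x - s i x)) \<partial>?M)
          + (\<integral>\<^sup>+ x. ennreal (norm (f x - s j x)) \<partial>?M)"
        by (rule norm_simple_bochner_integral_diff_le[OF S sm s s])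
      also have "\<dots> < ennreal (e / 2) + ennreal (e / 2)"
        by (intro add_strict_mono n ij)
      also have "\<dots> = ennreal e"
        using e by (simp flip: ennreal_plus)
      finally show ?thesis
        using e by (simp add: ennreal_less_iff)
    qed
    then show "\<exists>n. \<forall>i\<ge>n. \<forall>j\<ge>n. norm (?I i - ?I j) < e"
      by blast
  qed
  then obtain x where "?I \<longlonglongrightarrow> x"
    by (auto simp: Cauchy_convergent_iff convergent_def)
  then show ?thesis
    using sm s lim unfolding is_bochner_integral_def by blast
qed

section \<open>Comparison of Bochner and gauge integrals\<close>

text \<open>On every tagged division the Riemann sums of \<open>f\<close> and \<open>g\<close>
  differ by at most the Riemann sum of \<open>norm (f t - g t)\<close>, which is close to
  \<open>r\<close> on fine divisions. So closeness in L1 passes to gauge integrals with values in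
  any normed space.\<close>

lemma has_integral_approximable:
  fixes f :: "'a::euclidean_space \<Rightarrow> 'b::real_normed_vector"
  assumes approx: "\<And>e. 0 < e \<Longrightarrow> \<exists>g y r. (g has_integral y) (cbox a b) \<and> norm (y - x) < e \<and>
      ((\<lambda>t. norm (f t - g t)) has_integral r) (cbox a b) \<and> r < e"
  shows "(f has_integral x) (cbox a b)"
  unfolding has_integral
proof (intro allI impI)
  fix e :: real assume "0 < e"
  \<comment> \<open>Four errors are added: the size of \<open>r\<close>, the Riemann sum of
    \<open>norm (f t - g t)\<close> against \<open>r\<close>, the Riemann sum of \<open>g\<close>
    against \<open>y\<close>, and \<open>y\<close> against \<open>x\<close>.\<close>
  then have e: "0 < e / 4"
    by simp
  obtain g y r where g: "(g has_integral y) (cbox a b)" and y: "norm (y - x) < e / 4"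
    and d: "((\<lambda>t. norm (f t - g t)) has_integral r) (cbox a b)" and r: "r < e / 4"
    using approx[OF e] by blast
  have triangle: "norm (v - x) < e" if "norm (v - w) < e / 4 + e / 4" "norm (w - y) < e / 4" for v w
    using norm_triangle_lt[of "v - w" "w - x" e] norm_triangle_ineq[of "w - y" "y - x"] that y
    by simp
  let ?R = "\<lambda>\<D> h. \<Sum>(x, k)\<in>\<D>. measure lborel k *\<^sub>R h x"
  obtain \<gamma>1 where \<gamma>1: "gauge \<gamma>1"
    and g_sum: "\<And>\<D>. \<lbrakk>\<D> tagged_division_of cbox a b; \<gamma>1 fine \<D>\<rbrakk> \<Longrightarrow> norm (?R \<D> g - y) < e / 4"
    using g[unfolded has_integral, rule_format, OF e] by auto
  obtain \<gamma>2 where \<gamma>2: "gauge \<gamma>2"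
    and d_sum: "\<And>\<D>. \<lbrakk>\<D> tagged_division_of cbox a b; \<gamma>2 fine \<D>\<rbrakk> \<Longrightarrow>
      norm (?R \<D> (\<lambda>t. norm (f t - g t)) - r) < e / 4"
    using d[unfolded has_integral, rule_format, OF e] by auto
  show "\<exists>\<gamma>. gauge \<gamma> \<and> (\<forall>\<D>. \<D> tagged_division_of cbox a b \<and> \<gamma> fine \<D> \<longrightarrow> norm (?R \<D> f - x) < e)"
  proof (intro exI[of _ "\<lambda>x. \<gamma>1 x \<inter> \<gamma>2 x"] conjI allI impI)
    show "gauge (\<lambda>x. \<gamma>1 x \<inter> \<gamma>2 x)"
      using \<gamma>1 \<gamma>2 by (rule gauge_Int)
    fix \<D> assume "\<D> tagged_division_of cbox a b \<and> (\<lambda>x. \<gamma>1 x \<inter> \<gamma>2 x) fine \<D>"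
    then have \<D>: "\<D> tagged_division_of cbox a b" "\<gamma>1 fine \<D>" "\<gamma>2 fine \<D>"
      by (auto simp: fine_Int)
    have "norm (?R \<D> f - ?R \<D> g) = norm (\<Sum>(x, k)\<in>\<D>. measure lborel k *\<^sub>R (f x - g x))"
      by (simp add: sum_subtractf[symmetric] case_prod_unfold scaleR_diff_right)
    also have "\<dots> \<le> (\<Sum>(x, k)\<in>\<D>. measure lborel k *\<^sub>R norm (f x - g x))"
      by (intro sum_norm_le) auto
    also have "\<dots> < e / 4 + e / 4"
      using d_sum[OF \<D>(1,3)] r unfolding real_norm_def by linarith
    finally have "norm (?R \<D> f - ?R \<D> g) < e / 4 + e / 4" .
    moreover have "norm (?R \<D> g - y) < e / 4"
      by (rule g_sum[OF \<D>(1,2)])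
    ultimately show "norm (?R \<D> f - x) < e"
      by (rule triangle)
  qed
qed

text \<open>On a set of finite measure a simple function is the finite sum of its values times
  indicators of level sets of finite measure, and the gauge integral is additive.\<close>

lemma has_integral_simple_bochner_integral:
  fixes s :: "'a::euclidean_space \<Rightarrow> 'b::banach"
  assumes S: "S \<in> lmeasurable" and s: "simple_function (lebesgue_on S) s"
  shows "(s has_integral Bochner_Integration.simple_bochner_integral (lebesgue_on S) s) S"
proof -
  let ?A = "\<lambda>y. {x \<in> S. s x = y}"
  have fin: "finite (s ` S)"
    using simple_functionD(1)[OF s] by simp
  have meas: "?A y \<in> sets (lebesgue_on S)" for y
    using simple_functionD(2)[OF s, of "{y}"] by (simp add: vimage_def Int_def conj_commute)
  have A: "?A y \<in> lmeasurable" for y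
  proof (rule fmeasurableI2[OF S])
    show "?A y \<in> sets lebesgue"
      using meas[of y] S by (simp add: sets_restrict_space_iff fmeasurableD)
  qed auto
  have "((\<lambda>x. (indicator (?A y) x :: real) *\<^sub>R y) has_integral measure lebesgue (?A y) *\<^sub>R y) S" for y
  proof (rule has_integral_scaleR_left)
    have "indicator (?A y) = (\<lambda>x. if x \<in> S then (indicator (?A y) x :: real) else 0)"
      by (auto simp: fun_eq_iff indicator_def)
    moreover have "((indicator (?A y) :: 'a \<Rightarrow> real) has_integral measure lebesgue (?A y)) UNIV"
      using A[of y] by (simp add: lmeasurable_iff_has_integral)
    ultimately have "((\<lambda>x. if x \<in> S then (indicator (?A y) x :: real) else 0)
        has_integral measure lebesgue (?A y)) UNIV"
      by simp
    then show "((indicator (?A y) :: 'a \<Rightarrow> real) has_integral measure lebesgue (?A y)) S"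
      unfolding has_integral_restrict_UNIV .
  qed
  then have "((\<lambda>x. \<Sum>y\<in>s ` S. (indicator (?A y) x :: real) *\<^sub>R y) has_integral
      (\<Sum>y\<in>s ` S. measure lebesgue (?A y) *\<^sub>R y)) S"
    using fin by (intro has_integral_sum)
  moreover have "(\<Sum>y\<in>s ` S. (indicator (?A y) x :: real) *\<^sub>R y) = s x" if "x \<in> S" for x
  proof -
    have "(\<Sum>y\<in>s ` S. (indicator (?A y) x :: real) *\<^sub>R y) = (\<Sum>y\<in>s ` S. if s x = y then y else 0)"
      using that by (intro sum.cong) (auto simp: indicator_def)
    then show ?thesis
      using fin that by simp
  qed
  ultimately have "(s has_integral (\<Sum>y\<in>s ` S. measure lebesgue (?A y) *\<^sub>R y)) S"
    by (rule has_integral_eq[rotated])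
  moreover have "(\<Sum>y\<in>s ` S. measure lebesgue (?A y) *\<^sub>R y)
      = Bochner_Integration.simple_bochner_integral (lebesgue_on S) s"
    using S by (auto simp: Bochner_Integration.simple_bochner_integral_def measure_restrict_space
        fmeasurableD intro!: sum.cong)
  ultimately show ?thesis
    by simp
qed

text \<open>Gauge integrals need no separability and already satisfy every rule of calculation used
  below, so Bochner integrals over intervals are traded for them.\<close>

lemma is_bochner_integral_imp_has_integral:
  fixes f :: "real \<Rightarrow> 'b::banach"
  assumes "is_bochner_integral (lebesgue_on {a<..<b}) f x"
  shows "(f has_integral x) {a..b}"
proof -
  let ?M = "lebesgue_on {a<..<b}"
  have S: "{a<..<b} \<in> lmeasurable" "{a<..<b} \<in> sets lebesgue"
    by auto
  obtain s where sm: "strongly_measurable ?M f"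
    and s: "\<And>i::nat. Bochner_Integration.simple_bochner_integrable ?M (s i)"
    and lim: "(\<lambda>i. \<integral>\<^sup>+ y. ennreal (norm (f y - s i y)) \<partial>?M) \<longlonglongrightarrow> 0"
    and conv: "(\<lambda>i. Bochner_Integration.simple_bochner_integral ?M (s i)) \<longlonglongrightarrow> x"
    using assms unfolding is_bochner_integral_def by auto
  have s': "simple_function ?M (s i)" for i
    using s[of i] by (auto elim: Bochner_Integration.simple_bochner_integrable.cases)
  have "(f has_integral x) (cbox a b)"
  proof (rule has_integral_approximable)
    fix e :: real assume e: "0 < e"
    have "\<forall>\<^sub>F i in sequentially. (\<integral>\<^sup>+ y. ennreal (norm (f y - s i y)) \<partial>?M) < ennreal e"
      using e by (intro order_tendstoD(2)[OF lim]) auto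
    moreover have "\<forall>\<^sub>F i in sequentially.
        norm (Bochner_Integration.simple_bochner_integral ?M (s i) - x) < e"
      using tendstoD[OF conv e] by (simp add: dist_norm)
    ultimately obtain i where i: "(\<integral>\<^sup>+ y. ennreal (norm (f y - s i y)) \<partial>?M) < ennreal e"
      "norm (Bochner_Integration.simple_bochner_integral ?M (s i) - x) < e"
      using eventually_happens'[OF sequentially_bot eventually_conj] by blast
    obtain r where r: "0 \<le> r" "(\<integral>\<^sup>+ y. ennreal (norm (f y - s i y)) \<partial>?M) = ennreal r"
      using i(1) by (cases "\<integral>\<^sup>+ y. ennreal (norm (f y - s i y)) \<partial>?M") auto
    have "((\<lambda>t. norm (f t - s i t)) has_integral r) {a<..<b}"
      using strongly_measurable_norm_diff[OF S(2) sm s'] r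
      by (intro nonneg_has_integral_lebesgue_on S(2)) auto
    moreover have "r < e"
      using i(1) r e by (simp add: ennreal_less_iff)
    moreover have "(s i has_integral Bochner_Integration.simple_bochner_integral ?M (s i)) {a<..<b}"
      by (rule has_integral_simple_bochner_integral[OF S(1) s'])
    ultimately show "\<exists>g y r. (g has_integral y) (cbox a b) \<and> norm (y - x) < e \<and>
        ((\<lambda>t. norm (f t - g t)) has_integral r) (cbox a b) \<and> r < e"
      using i(2) by (auto simp: has_integral_Icc_iff_Ioo cbox_interval)
  qed
  then show ?thesis
    by simp
qed

lemma bochner_integrable_imp_integrable_on:
  fixes f :: "real \<Rightarrow> 'b::banach"
  assumes "bochner_integrable (lebesgue_on {a<..<b}) f"
  shows "f integrable_on {a..b}"
proof -
  obtain x where "is_bochner_integral (lebesgue_on {a<..<b}) f x"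
    using ex_is_bochner_integral[OF _ assms] by auto
  then show ?thesis
    using is_bochner_integral_imp_has_integral unfolding integrable_on_def by blast
qed

lemma bochner_integral_eq_integral:
  fixes f :: "real \<Rightarrow> 'b::banach"
  assumes "bochner_integrable (lebesgue_on {a<..<b}) f"
  shows "bochner_integral (lebesgue_on {a<..<b}) f = integral {a..b} f"
proof -
  obtain x where x: "is_bochner_integral (lebesgue_on {a<..<b}) f x"
    using ex_is_bochner_integral[OF _ assms] by auto
  \<comment> \<open>Any two candidates are both the gauge integral of \<open>f\<close>, so
    uniqueness of the latter determines the description.\<close>
  have "(THE y. is_bochner_integral (lebesgue_on {a<..<b}) f y) = x"
    by (rule the_equality[where P="is_bochner_integral (lebesgue_on {a<..<b}) f", OF x])
      (metis is_bochner_integral_imp_has_integral has_integral_unique x)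
  then show ?thesis
    using is_bochner_integral_imp_has_integral[OF x]
    by (simp add: bochner_integral_def integral_unique)
qed

subsection \<open>Integrability of the convolution integrand\<close>

lemma has_integral_reflect_Icc:
  fixes f :: "real \<Rightarrow> 'b::real_normed_vector"
  shows "((\<lambda>s. f (t - s)) has_integral i) {0..t} \<longleftrightarrow> (f has_integral i) {0..t}"
proof -
  \<comment> \<open>One implication suffices: reflecting twice is the identity, so the converse is
    the same implication applied to the reflected function.\<close>
  have *: "((\<lambda>s. g (t - s)) has_integral i) {0..t}" if "(g has_integral i) {0..t}" for g :: "real \<Rightarrow> 'b"
  proof -
    have "(\<lambda>x. t - x) ` {0..t} = {0..t}"
    proof safe
      fix x assume "x \<in> {0..t}"
      then show "x \<in> (\<lambda>x. t - x) ` {0..t}"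
        by (intro image_eqI[of _ _ "t - x"]) auto
    qed auto
    then show ?thesis
      using has_integral_affinity[of g i 0 t "- 1" t] that by simp
  qed
  show ?thesis
    using *[of f] *[of "\<lambda>s. f (t - s)"] by auto
qed

text \<open>The equivalence above rewrites the definition of \<open>integral\<close> together with
  its default value, so the identity covers every \<open>f\<close>.\<close>

lemma integral_reflect_Icc:
  fixes f :: "real \<Rightarrow> 'b::real_normed_vector"
  shows "integral {0..t} (\<lambda>s. f (t - s)) = integral {0..t} f"
  by (simp add: integral_def integrable_on_def has_integral_reflect_Icc)

lemma integrable_on_reflect_Icc:
  fixes f :: "real \<Rightarrow> 'b::real_normed_vector"
  shows "(\<lambda>s. f (t - s)) integrable_on {0..t} \<longleftrightarrow> f integrable_on {0..t}"
  by (simp add: integrable_on_def has_integral_reflect_Icc)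

lemma measurable_reflect_lebesgue: "(\<lambda>s::real. t - s) \<in> lebesgue \<rightarrow>\<^sub>M lebesgue"
  using lebesgue_affine_measurable[of "\<lambda>_::real. - 1" t] by simp

lemma measurable_reflect_lebesgue_on:
  "(\<lambda>s::real. t - s) \<in> lebesgue_on {0<..<t} \<rightarrow>\<^sub>M lebesgue_on {0<..<t}"
  by (intro measurable_restrict_space2 measurable_restrict_space1 measurable_reflect_lebesgue) auto

text \<open>Lebesgue measure is its own image under reflection, so null sets reflect to null sets;
  the density factor of the affine substitution is the absolute value of -1.\<close>

lemma AE_reflect_lebesgue_on:
  fixes t :: real
  assumes "AE s in lebesgue_on {0<..<t}. Q s"
  shows "AE s in lebesgue_on {0<..<t}. Q (t - s)"
proof -
  have "AE s in lebesgue. s \<in> {0<..<t} \<longrightarrow> Q s"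
    using assms by (simp add: AE_restrict_space_iff)
  then have "AE s in density (distr lebesgue lebesgue (\<lambda>x. t + - 1 * x)) (\<lambda>_. ennreal \<bar>- 1\<bar>).
      s \<in> {0<..<t} \<longrightarrow> Q s"
    by (subst lebesgue_real_affine[of "- 1" t, symmetric]) auto
  then have "AE s in distr lebesgue lebesgue (\<lambda>x. t + - 1 * x). s \<in> {0<..<t} \<longrightarrow> Q s"
    by (simp add: AE_density)
  moreover have "(\<lambda>x. t + - 1 * x) = (\<lambda>x. t - x)"
    by auto
  ultimately have "AE s in distr lebesgue lebesgue (\<lambda>x. t - x). s \<in> {0<..<t} \<longrightarrow> Q s"
    by (simp only:)
  then have "AE s in lebesgue. t - s \<in> {0<..<t} \<longrightarrow> Q (t - s)"
    by (rule AE_distrD[OF measurable_reflect_lebesgue])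
  then show ?thesis
    by (auto simp: AE_restrict_space_iff elim!: eventually_mono)
qed

lemma strongly_measurable_reflect:
  assumes "strongly_measurable (lebesgue_on {0<..<t::real}) f"
  shows "strongly_measurable (lebesgue_on {0<..<t}) (\<lambda>s. f (t - s))"
proof -
  obtain r where r: "\<And>i::nat. simple_function (lebesgue_on {0<..<t}) (r i)"
    and lim: "AE x in lebesgue_on {0<..<t}. (\<lambda>i. r i x) \<longlonglongrightarrow> f x"
    using assms unfolding strongly_measurable_def by blast
  have "simple_function (lebesgue_on {0<..<t}) (\<lambda>s. r i (t - s))" for i
    unfolding simple_function_eq_measurable
  proof
    show "finite ((\<lambda>s. r i (t - s)) ` space (lebesgue_on {0<..<t}))"
      by (rule finite_subset[OF _ simple_functionD(1)[OF r[of i]]]) auto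
    show "(\<lambda>s. r i (t - s)) \<in> lebesgue_on {0<..<t} \<rightarrow>\<^sub>M count_space UNIV"
      by (rule measurable_compose[OF measurable_reflect_lebesgue_on measurable_simple_function[OF r]])
  qed
  then show ?thesis
    using AE_reflect_lebesgue_on[OF lim] unfolding strongly_measurable_def
    by (intro exI[of _ "\<lambda>i s. r i (t - s)"] conjI allI)
qed

text \<open>The approximants are the values of \<open>g\<close> at the grid point of spacing
  \<open>1 / Suc n\<close> just below \<open>s\<close>. A bounded interval meets finitely many grid
  cells, so they are simple, and continuity of \<open>g\<close> gives the limit.\<close>

lemma strongly_measurable_continuous_on:
  fixes g :: "real \<Rightarrow> 'b::real_normed_vector"
  assumes g: "continuous_on {0..t} g"
  shows "strongly_measurable (lebesgue_on {0<..<t}) g"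
proof -
  let ?M = "lebesgue_on {0<..<t}"
  \<comment> \<open>Measurability is checked for the integer index only, since any function of a
    simple function is simple. Rounding down a positive \<open>s\<close> keeps the grid point in
    \<open>{0..t}\<close>, where \<open>g\<close> is continuous.\<close>
  define q where "q n s = \<lfloor>real (Suc n) * s\<rfloor>" for n s
  have "simple_function ?M (q n)" for n
    unfolding simple_function_eq_measurable
  proof
    have "q n ` space ?M \<subseteq> {0..\<lfloor>real (Suc n) * t\<rfloor>}"
      by (auto simp: q_def intro!: floor_mono mult_left_mono)
    then show "finite (q n ` space ?M)"
      by (rule finite_subset) simp
    have "q n \<in> lebesgue \<rightarrow>\<^sub>M count_space UNIV"
      unfolding q_def by (intro measurable_completion) (simp, measurable)
    then show "q n \<in> ?M \<rightarrow>\<^sub>M count_space UNIV"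
      by (rule measurable_restrict_space1)
  qed
  then have "simple_function ?M (\<lambda>s. g (of_int (q n s) / real (Suc n)))" for n
    by (rule simple_function_compose1)
  moreover have "(\<lambda>n. g (of_int (q n s) / real (Suc n))) \<longlonglongrightarrow> g s" if s: "s \<in> {0<..<t}" for s
  proof (rule continuous_on_tendsto_compose[OF g])
    have lo: "s - 1 / real (Suc n) \<le> of_int (q n s) / real (Suc n)" for n
    proof -
      have "real (Suc n) * s - 1 \<le> of_int (q n s)"
        unfolding q_def by linarith
      then have "(real (Suc n) * s - 1) / real (Suc n) \<le> of_int (q n s) / real (Suc n)"
        by (rule divide_right_mono) simp
      then show ?thesis
        by (simp add: diff_divide_distrib del: of_nat_Suc)
    qed
    have up: "of_int (q n s) / real (Suc n) \<le> s" for n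
    proof -
      have "of_int (q n s) \<le> real (Suc n) * s"
        unfolding q_def by linarith
      then show ?thesis
        by (simp add: field_simps)
    qed
    have nn: "0 \<le> of_int (q n s) / real (Suc n)" for n
      using s by (auto simp: q_def)
    have "(\<lambda>n. s - 1 / real (Suc n)) \<longlonglongrightarrow> s - 0"
      using LIMSEQ_Suc[OF lim_1_over_n] by (rule tendsto_diff[OF tendsto_const])
    then have lim: "(\<lambda>n. s - 1 / real (Suc n)) \<longlonglongrightarrow> s"
      by simp
    show "(\<lambda>n. of_int (q n s) / real (Suc n)) \<longlonglongrightarrow> s"
      using lo up by (intro real_tendsto_sandwich[OF _ _ lim tendsto_const] always_eventually allI)
    show "\<forall>\<^sub>F n in sequentially. of_int (q n s) / real (Suc n) \<in> {0..t}"
    proof (intro always_eventually allI)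
      fix n
      show "of_int (q n s) / real (Suc n) \<in> {0..t}"
        using nn[of n] order_trans[OF up[of n], of t] s by simp
    qed
  qed (use s in auto)
  then have "AE s in ?M. (\<lambda>n. g (of_int (q n s) / real (Suc n))) \<longlonglongrightarrow> g s"
    by (intro AE_I2) (simp del: of_nat_Suc)
  ultimately show ?thesis
    unfolding strongly_measurable_def
    by (intro exI[of _ "\<lambda>n s. g (of_int (q n s) / real (Suc n))"]) simp
qed

text \<open>Evaluation of operators is jointly continuous in operator norm and vector norm, and it
  maps pairs of simple functions to simple functions.\<close>

lemma strongly_measurable_blinfun_apply:
  assumes "strongly_measurable M F" "strongly_measurable M g"
  shows "strongly_measurable M (\<lambda>s. blinfun_apply (F s) (g s))"
proof -
  obtain p where p: "\<And>i::nat. simple_function M (p i)" and lim_p: "AE x in M. (\<lambda>i. p i x) \<longlonglongrightarrow> F x"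
    using assms(1) unfolding strongly_measurable_def by blast
  obtain q where q: "\<And>i::nat. simple_function M (q i)" and lim_q: "AE x in M. (\<lambda>i. q i x) \<longlonglongrightarrow> g x"
    using assms(2) unfolding strongly_measurable_def by blast
  have "simple_function M (\<lambda>x. blinfun_apply (p i x) (q i x))" for i
    by (rule simple_function_compose2[OF p q])
  moreover have "AE x in M. (\<lambda>i. blinfun_apply (p i x) (q i x)) \<longlonglongrightarrow> blinfun_apply (F x) (g x)"
    using lim_p lim_q by eventually_elim (rule blinfun.tendsto)
  ultimately show ?thesis
    unfolding strongly_measurable_def
    by (intro exI[of _ "\<lambda>i x. blinfun_apply (p i x) (q i x)"] conjI allI)
qed

lemma bochner_integrable_convolution:
  fixes P :: "real \<Rightarrow> ('a::banach \<Rightarrow>\<^sub>L 'a)"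
  assumes P: "bochner_integrable (lebesgue_on {0<..<t}) P" and g: "continuous_on {0..t} g"
  shows "bochner_integrable (lebesgue_on {0<..<t}) (\<lambda>s. blinfun_apply (P (t - s)) (g s))"
proof -
  let ?M = "lebesgue_on {0<..<t}"
  have "bounded (g ` {0..t})"
    using g by (intro compact_imp_bounded compact_continuous_image) auto
  then obtain B where "\<forall>y\<in>g ` {0..t}. norm y \<le> B"
    unfolding bounded_iff by blast
  then have B: "norm (g s) \<le> B" if "s \<in> {0..t}" for s
    using that by blast
  have "(\<lambda>r. norm (P r)) integrable_on {0..t}"
    using bochner_integrable_norm_integrable_on[OF _ P] by (simp add: integrable_on_Icc_iff_Ioo)
  then have "(\<lambda>s. norm (P (t - s))) integrable_on {0..t}"
    by (simp add: integrable_on_reflect_Icc[where f="\<lambda>r. norm (P r)"])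
  \<comment> \<open>The absolute value keeps the dominating function nonnegative also when
    \<open>{0..t}\<close> is empty and \<open>B\<close> is arbitrary.\<close>
  then have "(\<lambda>s. \<bar>B\<bar> * norm (P (t - s))) integrable_on {0<..<t}"
    unfolding integrable_on_Icc_iff_Ioo by (rule integrable_on_mult_right)
  then have "(\<integral>\<^sup>+ s. ennreal (\<bar>B\<bar> * norm (P (t - s))) \<partial>?M) < \<infinity>"
    by (subst nonneg_nn_integral_lebesgue_on) auto
  moreover have "norm (blinfun_apply (P (t - s)) (g s)) \<le> \<bar>B\<bar> * norm (P (t - s))"
    if "s \<in> {0<..<t}" for s
  proof -
    have "norm (blinfun_apply (P (t - s)) (g s)) \<le> norm (P (t - s)) * norm (g s)"
      by (rule norm_blinfun)
    also have "\<dots> \<le> norm (P (t - s)) * \<bar>B\<bar>"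
      using B[of s] that by (intro mult_left_mono) auto
    finally show ?thesis
      by (simp add: mult.commute)
  qed
  then have "(\<integral>\<^sup>+ s. ennreal (norm (blinfun_apply (P (t - s)) (g s))) \<partial>?M)
      \<le> (\<integral>\<^sup>+ s. ennreal (\<bar>B\<bar> * norm (P (t - s))) \<partial>?M)"
    by (intro nn_integral_mono ennreal_leI) auto
  ultimately have "(\<integral>\<^sup>+ s. ennreal (norm (blinfun_apply (P (t - s)) (g s))) \<partial>?M) < \<infinity>"
    by (rule le_less_trans[rotated])
  moreover have "strongly_measurable ?M P"
    using P by (simp add: bochner_integrable_def)
  ultimately show ?thesis
    unfolding bochner_integrable_def
    using strongly_measurable_blinfun_apply[OF strongly_measurable_reflect
        strongly_measurable_continuous_on[OF g]] by blast
qed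

subsection \<open>The convolution operator\<close>

locale locally_L1_kernel =
  fixes P :: "real \<Rightarrow> ('a::banach \<Rightarrow>\<^sub>L 'a)"
  assumes L1: "\<And>T. T > 0 \<Longrightarrow> bochner_integrable (lebesgue_on {0<..<T}) P"
begin

section \<open>Accumulated norm of the kernel\<close>

definition mass :: "real \<Rightarrow> real" where
  "mass t = integral {0..t} (\<lambda>r. norm (P r))"

text \<open>A gauge integral, so that the rules of calculation apply directly; for continuous
  \<open>g\<close> and \<open>t \<ge> 0\<close> it is shown below to be the Bochner convolution
  integral.\<close>

definition duhamel :: "(real \<Rightarrow> 'a) \<Rightarrow> real \<Rightarrow> 'a" where
  "duhamel g t = integral {0..t} (\<lambda>s. blinfun_apply (P (t - s)) (g s))"

lemma norm_kernel_integrable_on: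
  assumes "0 \<le> a"
  shows "(\<lambda>r. norm (P r)) integrable_on {a..b}"
proof -
  \<comment> \<open>The bound \<open>max b 1\<close> is positive, as \<open>L1\<close> demands,
    whatever \<open>b\<close> is.\<close>
  have "(\<lambda>r. norm (P r)) integrable_on {0<..<max b 1}"
    by (rule bochner_integrable_norm_integrable_on[OF _ L1]) auto
  then have "(\<lambda>r. norm (P r)) integrable_on {0..max b 1}"
    by (simp add: integrable_on_Icc_iff_Ioo)
  then show ?thesis
    by (rule integrable_on_subinterval) (use assms in auto)
qed

lemma mass_mono:
  assumes "s \<le> t"
  shows "mass s \<le> mass t"
  unfolding mass_def using assms by (intro integral_subset_le norm_kernel_integrable_on) auto

lemma mass_nonneg: "0 \<le> mass t"
  unfolding mass_def by (intro integral_nonneg norm_kernel_integrable_on) auto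

lemma mass_diff:
  assumes "0 \<le> s" "s \<le> t"
  shows "integral {s..t} (\<lambda>r. norm (P r)) = mass t - mass s"
  using Henstock_Kurzweil_Integration.integral_combine[OF assms norm_kernel_integrable_on[of 0 t]]
  by (simp add: mass_def)

lemma continuous_on_mass: "continuous_on {0..T} mass"
  unfolding mass_def by (intro indefinite_integral_continuous_1 norm_kernel_integrable_on) simp

lemma mass_small:
  assumes "0 < e"
  obtains d where "0 < d" "mass d < e"
proof -
  obtain d where d: "0 < d" "\<And>t. t \<in> {0..1} \<Longrightarrow> dist t 0 < d \<Longrightarrow> dist (mass t) (mass 0) < e"
    using continuous_on_mass[of 1, unfolded continuous_on_iff, rule_format, of 0 e] assms by auto
  \<comment> \<open>The point \<open>min (d / 2) 1\<close> is positive, closer to 0 than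
    \<open>d\<close>, and inside the unit interval on which continuity is invoked.\<close>
  have "dist (mass (min (d / 2) 1)) (mass 0) < e"
    using d(1) by (intro d(2)) (auto simp: dist_real_def)
  then have "mass (min (d / 2) 1) < e"
    by (simp add: mass_def dist_real_def)
  then show thesis
    using d(1) by (intro that[of "min (d / 2) 1"]) auto
qed

section \<open>Integrability, estimates and continuity of the convolution term\<close>

lemma bochner_integrable_duhamel:
  assumes "0 \<le> t" "continuous_on {0..t} g"
  shows "bochner_integrable (lebesgue_on {0<..<t}) (\<lambda>s. blinfun_apply (P (t - s)) (g s))"
proof -
  have "bochner_integrable (lebesgue_on {0<..<t}) P"
  \<comment> \<open>\<open>L1\<close> speaks of positive end points; at \<open>t = 0\<close> the
    domain is empty and carries the zero measure.\<close>
  proof (cases "t = 0")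
    case True
    have "emeasure (lebesgue_on {} :: real measure) (space (lebesgue_on {})) = 0"
      by simp
    moreover have "strongly_measurable (lebesgue_on {} :: real measure) P"
      unfolding strongly_measurable_def
      by (intro exI[of _ "\<lambda>_ _. 0"] conjI allI simple_function_const AE_I2) simp
    ultimately show ?thesis
      using True by (simp add: bochner_integrable_def nn_integral_empty)
  qed (use assms(1) in \<open>auto intro: L1\<close>)
  then show ?thesis
    using assms(2) by (rule bochner_integrable_convolution)
qed

lemma duhamel_integrable_on:
  assumes "0 \<le> t" "continuous_on {0..t} g"
  shows "(\<lambda>r. blinfun_apply (P r) (g (t - r))) integrable_on {0..t}"
  using bochner_integrable_imp_integrable_on[OF bochner_integrable_duhamel[OF assms]]
    integrable_on_reflect_Icc[of "\<lambda>r. blinfun_apply (P r) (g (t - r))" t] by simp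

lemma bochner_integral_eq_duhamel:
  assumes "0 \<le> t" "continuous_on {0..t} g"
  shows "bochner_integral (lebesgue_on {0<..<t}) (\<lambda>s. blinfun_apply (P (t - s)) (g s)) = duhamel g t"
  unfolding duhamel_def by (rule bochner_integral_eq_integral[OF bochner_integrable_duhamel[OF assms]])

text \<open>In this form two convolution terms carry the same factor \<open>P r\<close>, so only
  values of \<open>g\<close> have to be compared, also at different times.\<close>

lemma duhamel_reflect: "duhamel g t = integral {0..t} (\<lambda>r. blinfun_apply (P r) (g (t - r)))"
  unfolding duhamel_def
  using integral_reflect_Icc[of t "\<lambda>r. blinfun_apply (P r) (g (t - r))"] by simp

text \<open>After reflection the integrands agree for \<open>r > t - a\<close>, because
  \<open>t - r\<close> then lies before \<open>a\<close>. Only the mass of the kernel on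
  \<open>{0..t - a}\<close> contributes.\<close>

lemma norm_duhamel_diff_le:
  assumes a: "0 \<le> a" "a \<le> t" and g: "continuous_on {0..t} g" and h: "continuous_on {0..t} h"
    and eq: "\<And>s. 0 \<le> s \<Longrightarrow> s < a \<Longrightarrow> g s = h s"
    and le: "\<And>s. a \<le> s \<Longrightarrow> s \<le> t \<Longrightarrow> norm (g s - h s) \<le> m"
  shows "norm (duhamel g t - duhamel h t) \<le> m * mass (t - a)"
proof -
  let ?d = "\<lambda>r. blinfun_apply (P r) (g (t - r)) - blinfun_apply (P r) (h (t - r))"
  let ?b = "\<lambda>r. if r \<in> {0..t - a} then m * norm (P r) else 0"
  have t: "0 \<le> t"
    using a by simp
  have int: "{0..t - a} \<inter> {0..t} = {0..t - a}"
    using a by auto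
  have "duhamel g t - duhamel h t = integral {0..t} ?d"
    unfolding duhamel_reflect
    by (rule integral_diff[symmetric, OF duhamel_integrable_on[OF t g] duhamel_integrable_on[OF t h]])
  also have "norm \<dots> \<le> integral {0..t} ?b"
  proof (rule integral_norm_bound_integral)
    show "?d integrable_on {0..t}"
      by (rule integrable_diff[OF duhamel_integrable_on[OF t g] duhamel_integrable_on[OF t h]])
    have "(\<lambda>r. m * norm (P r)) integrable_on {0..t - a}"
      by (intro integrable_on_mult_right norm_kernel_integrable_on) simp
    then show "?b integrable_on {0..t}"
      by (simp only: integrable_restrict_Int int)
    fix r assume r: "r \<in> {0..t}"
    show "norm (?d r) \<le> ?b r"
    proof (cases "r \<le> t - a")
      case True
      have "norm (?d r) \<le> norm (P r) * norm (g (t - r) - h (t - r))"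
        using norm_blinfun[of "P r" "g (t - r) - h (t - r)"] by (simp add: blinfun.diff_right)
      also have "\<dots> \<le> norm (P r) * m"
        using True r by (intro mult_left_mono le) auto
      finally show ?thesis
        using True r by (simp add: mult.commute)
    next
      case False
      then show ?thesis
        using r eq[of "t - r"] by simp
    qed
  qed
  also have "\<dots> = m * mass (t - a)"
    by (simp only: integral_restrict_Int int mass_def Henstock_Kurzweil_Integration.integral_mult_right)
  finally show ?thesis .
qed

lemma norm_duhamel_le:
  assumes "0 \<le> t" "continuous_on {0..t} g" "\<And>s. 0 \<le> s \<Longrightarrow> s \<le> t \<Longrightarrow> norm (g s) \<le> m"
  shows "norm (duhamel g t) \<le> m * mass t"
  using norm_duhamel_diff_le[of 0 t g "\<lambda>_. 0" m] assms by (simp add: duhamel_def)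

text \<open>The longer integral is split at \<open>t\<close>. On \<open>{0..t}\<close> the kernel is
  the same and \<open>g\<close> is shifted by \<open>t' - t\<close>; on \<open>{t..t'}\<close> the
  bound of \<open>g\<close> multiplies the remaining mass.\<close>

lemma duhamel_increment_le:
  assumes t: "0 \<le> t" "t \<le> t'" and g: "continuous_on {0..t'} g"
    and inc: "\<And>r. r \<in> {0..t} \<Longrightarrow> norm (g (t' - r) - g (t - r)) \<le> e"
    and B: "\<And>s. s \<in> {0..t'} \<Longrightarrow> norm (g s) \<le> B"
  shows "norm (duhamel g t' - duhamel g t) \<le> e * mass t + B * (mass t' - mass t)"
proof -
  let ?f = "\<lambda>r. blinfun_apply (P r) (g (t' - r))"
  let ?h = "\<lambda>r. blinfun_apply (P r) (g (t - r))"
  have f: "?f integrable_on {0..t'}"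
    using t g by (intro duhamel_integrable_on) auto
  have f1: "?f integrable_on {0..t}" and f2: "?f integrable_on {t..t'}"
    using t by (auto intro: integrable_on_subinterval[OF f])
  have h: "?h integrable_on {0..t}"
    using t g by (intro duhamel_integrable_on) (auto elim: continuous_on_subset)
  have "duhamel g t' - duhamel g t = integral {0..t} (\<lambda>r. ?f r - ?h r) + integral {t..t'} ?f"
    unfolding duhamel_reflect integral_diff[OF f1 h]
    using Henstock_Kurzweil_Integration.integral_combine[OF t f] by simp
  moreover have "norm (integral {0..t} (\<lambda>r. ?f r - ?h r)) \<le> integral {0..t} (\<lambda>r. e * norm (P r))"
  proof (rule integral_norm_bound_integral[OF integrable_diff[OF f1 h]])
    show "(\<lambda>r. e * norm (P r)) integrable_on {0..t}"
      by (intro integrable_on_mult_right norm_kernel_integrable_on) simp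
    fix r assume "r \<in> {0..t}"
    then have "norm (P r) * norm (g (t' - r) - g (t - r)) \<le> norm (P r) * e"
      by (intro mult_left_mono inc) auto
    then show "norm (?f r - ?h r) \<le> e * norm (P r)"
      using norm_blinfun[of "P r" "g (t' - r) - g (t - r)"] by (simp add: blinfun.diff_right mult.commute)
  qed
  moreover have "norm (integral {t..t'} ?f) \<le> integral {t..t'} (\<lambda>r. B * norm (P r))"
  proof (rule integral_norm_bound_integral[OF f2])
    show "(\<lambda>r. B * norm (P r)) integrable_on {t..t'}"
      using t by (intro integrable_on_mult_right norm_kernel_integrable_on)
    fix r assume "r \<in> {t..t'}"
    then have "norm (P r) * norm (g (t' - r)) \<le> norm (P r) * B"
      using t by (intro mult_left_mono B) auto
    then show "norm (?f r) \<le> B * norm (P r)"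
      using norm_blinfun[of "P r" "g (t' - r)"] by (simp add: mult.commute)
  qed
  ultimately show ?thesis
    using norm_triangle_ineq[of "integral {0..t} (\<lambda>r. ?f r - ?h r)" "integral {t..t'} ?f"]
    by (simp add: mass_diff[OF t] mass_def[of t, symmetric])
qed

lemma continuous_on_duhamel:
  assumes g: "continuous_on {0..T} g"
  shows "continuous_on {0..T} (duhamel g)"
proof -
  have "bounded (g ` {0..T})"
    using g by (intro compact_imp_bounded compact_continuous_image) auto
  then obtain B where B0: "0 < B" and "\<forall>y\<in>g ` {0..T}. norm y \<le> B"
    unfolding bounded_pos by blast
  then have B: "norm (g s) \<le> B" if "s \<in> {0..T}" for s
    using that by blast
  have "\<exists>d>0. \<forall>t\<in>{0..T}. \<forall>t'\<in>{0..T}. t \<le> t' \<longrightarrow> t' - t < d \<longrightarrow> norm (duhamel g t' - duhamel g t) < e"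
    if e: "0 < e" for e
  proof -
    \<comment> \<open>Each of the two terms of the increment estimate gets \<open>e / 2\<close>. The
      summand 1 keeps the denominator positive and makes \<open>e1 * mass T < e / 2\<close>
      strict.\<close>
    define e1 where "e1 = e / (2 * (mass T + 1))"
    define e2 where "e2 = e / (2 * B)"
    have e12: "0 < e1" "0 < e2"
      using e B0 mass_nonneg[of T] by (auto simp: e1_def e2_def)
    obtain d1 where d1: "0 < d1" "\<And>x y. \<lbrakk>x \<in> {0..T}; y \<in> {0..T}; dist y x < d1\<rbrakk> \<Longrightarrow> dist (g y) (g x) < e1"
      using compact_uniformly_continuous[OF g] e12(1) unfolding uniformly_continuous_on_def
      by (metis compact_Icc)
    obtain d2 where d2: "0 < d2" "\<And>x y. \<lbrakk>x \<in> {0..T}; y \<in> {0..T}; dist y x < d2\<rbrakk> \<Longrightarrow> dist (mass y) (mass x) < e2"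
      using compact_uniformly_continuous[OF continuous_on_mass[of T]] e12(2)
      unfolding uniformly_continuous_on_def by (metis compact_Icc)
    have "norm (duhamel g t' - duhamel g t) < e"
      if t: "t \<in> {0..T}" "t' \<in> {0..T}" "t \<le> t'" "t' - t < min d1 d2" for t t'
    proof -
      have "norm (duhamel g t' - duhamel g t) \<le> e1 * mass t + B * (mass t' - mass t)"
      proof (rule duhamel_increment_le)
        show "norm (g (t' - r) - g (t - r)) \<le> e1" if "r \<in> {0..t}" for r
          using d1(2)[of "t - r" "t' - r"] that t by (auto simp: dist_norm)
      qed (use t g B in \<open>auto elim: continuous_on_subset\<close>)
      moreover have "e1 * mass t \<le> e1 * mass T"
        using t e12 by (intro mult_left_mono mass_mono) auto
      moreover have "e1 * mass T < e / 2"
        using e mass_nonneg[of T] by (simp add: e1_def divide_simps)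
      moreover have "mass t' - mass t < e2"
        using d2(2)[OF t(1,2)] t by (auto simp: dist_real_def)
      then have "B * (mass t' - mass t) < B * e2"
        using B0 by (rule mult_strict_left_mono)
      moreover have "B * e2 = e / 2"
        using B0 by (simp add: e2_def)
      ultimately show ?thesis
        by linarith
    qed
    then show ?thesis
      using d1(1) d2(1) by (intro exI[of _ "min d1 d2"]) simp
  qed
  note key = this
  show ?thesis
    unfolding continuous_on_iff
  proof (intro ballI allI impI)
    fix t e :: real assume t: "t \<in> {0..T}" and "0 < e"
    then obtain d where "0 < d" and
      d: "\<forall>t\<in>{0..T}. \<forall>t'\<in>{0..T}. t \<le> t' \<longrightarrow> t' - t < d \<longrightarrow> norm (duhamel g t' - duhamel g t) < e"
      using key by blast
    have "dist (duhamel g t') (duhamel g t) < e" if t': "t' \<in> {0..T}" "dist t' t < d" for t'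
    \<comment> \<open>The modulus above is for ordered times; in the other order the two times are
      exchanged.\<close>
    proof (cases "t \<le> t'")
      case True
      then show ?thesis
        using d t t' by (auto simp: dist_norm)
    next
      case False
      then have "norm (duhamel g t - duhamel g t') < e"
        using d t t' by (auto simp: dist_norm)
      then show ?thesis
        by (simp add: dist_norm norm_minus_commute)
    qed
    then show "\<exists>d>0. \<forall>t'\<in>{0..T}. dist t' t < d \<longrightarrow> dist (duhamel g t') (duhamel g t) < e"
      using \<open>0 < d\<close> by blast
  qed
qed

end

section \<open>Existence intervals and the nonlinearity\<close>

lemma existence_interval_Icc_subset:
  assumes "existence_interval J" "t \<in> J"
  shows "0 \<le> t" "{0..t} \<subseteq> J"
  using assms by (auto simp: existence_interval_def)

lemma lipschitz_on_bounded_setsE: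
  assumes "lipschitz_on_bounded_sets N" "0 < R"
  obtains L where "0 \<le> L" "L-lipschitz_on (cball 0 R) N"
  using assms unfolding lipschitz_on_bounded_sets_def using lipschitz_on_nonneg by blast

text \<open>Continuity is local: each \<open>x\<close> is interior to the ball of radius
  \<open>norm x + 1\<close>, on which \<open>N\<close> is Lipschitz.\<close>

lemma lipschitz_on_bounded_sets_imp_continuous_on:
  fixes N :: "'a::real_normed_vector \<Rightarrow> 'a"
  assumes "lipschitz_on_bounded_sets N"
  shows "continuous_on A N"
proof (intro continuous_at_imp_continuous_on ballI)
  fix x :: 'a
  have R: "0 < norm x + 1"
    by (simp add: add_nonneg_pos)
  obtain L where "L-lipschitz_on (cball 0 (norm x + 1)) N"
    using lipschitz_on_bounded_setsE[OF assms R] by blast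
  then have "continuous_on (cball 0 (norm x + 1)) N"
    by (rule lipschitz_on_continuous_on)
  moreover have "x \<in> interior (cball 0 (norm x + 1))"
    using ball_subset_cball by (intro interiorI[of "ball 0 (norm x + 1)"]) auto
  ultimately show "isCont N x"
    by (rule continuous_on_interior)
qed

subsection \<open>Mild solutions\<close>

context locally_L1_kernel
begin

text \<open>Continuity of \<open>u\<close> makes \<open>N (u s)\<close> continuous on each
  \<open>{0..t}\<close>, hence the integrand Bochner integrable and its Bochner integral equal to
  \<open>duhamel\<close>. From here on mild solutions are fixed points of a gauge-integral
  equation.\<close>

lemma mild_solution_iff_duhamel:
  assumes N: "lipschitz_on_bounded_sets N"
  shows "mild_solution S P N u0 J u \<longleftrightarrow> existence_interval J \<and> continuous_on J u \<and>
    (\<forall>t\<in>J. u t = blinfun_apply (S t) u0 + duhamel (\<lambda>s. N (u s)) t)"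
proof (cases "existence_interval J \<and> continuous_on J u")
  case True
  have "bochner_integrable (lebesgue_on {0<..<t}) (\<lambda>s. blinfun_apply (P (t - s)) (N (u s)))
      \<and> bochner_integral (lebesgue_on {0<..<t}) (\<lambda>s. blinfun_apply (P (t - s)) (N (u s)))
        = duhamel (\<lambda>s. N (u s)) t" if "t \<in> J" for t
  proof -
    have t: "0 \<le> t" "{0..t} \<subseteq> J"
      using existence_interval_Icc_subset True that by blast+
    then have "continuous_on {0..t} (\<lambda>s. N (u s))"
      using True continuous_on_subset
      by (intro continuous_on_compose2[OF lipschitz_on_bounded_sets_imp_continuous_on[OF N, of UNIV]]) auto
    then show ?thesis
      using t(1) bochner_integrable_duhamel bochner_integral_eq_duhamel by blast
  qed
  then show ?thesis
    by (auto simp: mild_solution_def)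
qed (auto simp: mild_solution_def)

text \<open>One ball contains the values of both functions on all of \<open>{0..T}\<close>, so a
  single Lipschitz constant and a single step \<open>d\<close> serve throughout, and equality
  spreads from each multiple of \<open>d\<close> to the next.\<close>

lemma duhamel_fixed_point_unique:
  assumes N: "lipschitz_on_bounded_sets N"
    and u: "continuous_on {0..T} u" "\<And>t. t \<in> {0..T} \<Longrightarrow> u t = f t + duhamel (\<lambda>s. N (u s)) t"
    and v: "continuous_on {0..T} v" "\<And>t. t \<in> {0..T} \<Longrightarrow> v t = f t + duhamel (\<lambda>s. N (v s)) t"
    and t: "t \<in> {0..T}"
  shows "u t = v t"
proof -
  have "bounded (u ` {0..T} \<union> v ` {0..T})"
    unfolding bounded_Un using u(1) v(1) by (intro conjI compact_imp_bounded compact_continuous_image) auto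
  then obtain R where R: "0 < R" and "\<forall>y\<in>u ` {0..T} \<union> v ` {0..T}. norm y \<le> R"
    unfolding bounded_pos by blast
  then have R_bound: "u s \<in> cball 0 R" "v s \<in> cball 0 R" if "s \<in> {0..T}" for s
    using that by auto
  obtain L where L: "0 \<le> L" "L-lipschitz_on (cball 0 R) N"
    using lipschitz_on_bounded_setsE[OF N R] by blast
  \<comment> \<open>Chosen so that \<open>L * mass d\<close> is at most 1/2; the summand 1 keeps the
    denominator positive when \<open>L = 0\<close>.\<close>
  obtain d where d: "0 < d" "mass d < 1 / (2 * (L + 1))"
    using mass_small[of "1 / (2 * (L + 1))"] L(1) by auto
  have "L * mass d \<le> (L + 1) * (1 / (2 * (L + 1)))"
    using L(1) d(2) mass_nonneg[of d] by (intro mult_mono) auto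
  also have "\<dots> = 1 / 2"
    using L(1) by simp
  finally have Ld: "L * mass d \<le> 1 / 2" .
  have Nu: "continuous_on {0..x} (\<lambda>s. N (u s))" and Nv: "continuous_on {0..x} (\<lambda>s. N (v s))"
    if "x \<le> T" for x
    using that continuous_on_subset[OF u(1), of "{0..x}"] continuous_on_subset[OF v(1), of "{0..x}"]
    by (auto intro!: continuous_on_compose2[OF lipschitz_on_bounded_sets_imp_continuous_on[OF N, of UNIV]])
  have step: "\<forall>t\<in>{0..T}. t \<le> real n * d \<longrightarrow> u t = v t" for n
  proof (induction n)
    case 0
    then show ?case
      \<comment> \<open>Only \<open>t = 0\<close> is left, where the convolution integral runs over
        a single point and vanishes.\<close>
      using u(2)[of 0] v(2)[of 0] by (auto simp: duhamel_def)
  next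
    case (Suc n)
    show ?case
    proof (intro ballI impI)
      fix t assume t: "t \<in> {0..T}" "t \<le> real (Suc n) * d"
      define a where "a = real n * d"
      have a0: "0 \<le> a"
        using d(1) by (simp add: a_def)
      show "u t = v t"
      proof (cases "t \<le> a")
        case True
        then show ?thesis
          using Suc t by (simp add: a_def)
      next
        case False
        then have "a \<le> t"
          by simp
        have "continuous_on {a..t} (\<lambda>s. norm (u s - v s))"
          using a0 t(1) by (intro continuous_intros continuous_on_subset[OF u(1)] continuous_on_subset[OF v(1)]) auto
        moreover have "{a..t} \<noteq> {}"
          using \<open>a \<le> t\<close> by simp
        \<comment> \<open>The estimate is applied at a point \<open>x\<close> where the difference
          is largest on \<open>{a..t}\<close>. Since \<open>x - a \<le> d\<close>, this maximum is
          at most half of itself, hence zero.\<close>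
        ultimately obtain x where x: "x \<in> {a..t}"
          and max: "\<And>s. s \<in> {a..t} \<Longrightarrow> norm (u s - v s) \<le> norm (u x - v x)"
          using continuous_attains_sup[OF compact_Icc] by blast
        let ?m = "norm (u x - v x)"
        have xT: "x \<in> {0..T}"
          using x t(1) a0 by auto
        have "?m = norm (duhamel (\<lambda>s. N (u s)) x - duhamel (\<lambda>s. N (v s)) x)"
          using u(2)[OF xT] v(2)[OF xT] by simp
        moreover have "norm (duhamel (\<lambda>s. N (u s)) x - duhamel (\<lambda>s. N (v s)) x) \<le> (L * ?m) * mass (x - a)"
        proof (rule norm_duhamel_diff_le[OF a0 _ Nu Nv])
          fix s assume "0 \<le> s" "s < a"
          then have "u s = v s"
            using Suc x xT by (simp add: a_def)
          then show "N (u s) = N (v s)"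
            by simp
        next
          fix s assume s: "a \<le> s" "s \<le> x"
          then have "s \<in> {0..T}"
            using a0 xT by auto
          then have "norm (N (u s) - N (v s)) \<le> L * norm (u s - v s)"
            using lipschitz_onD[OF L(2) R_bound] by (simp add: dist_norm)
          also have "\<dots> \<le> L * ?m"
            using s x L(1) by (intro mult_left_mono max) auto
          finally show "norm (N (u s) - N (v s)) \<le> L * ?m" .
        qed (use x xT in auto)
        moreover have "(L * ?m) * mass (x - a) \<le> (L * ?m) * mass d"
          using x t(2) L(1) by (intro mult_left_mono mass_mono) (auto simp: a_def algebra_simps)
        moreover have "(L * ?m) * mass d \<le> ?m * (1 / 2)"
          using mult_left_mono[OF Ld, of ?m] by (simp add: mult.assoc mult.left_commute)
        ultimately have "?m \<le> ?m * (1 / 2)"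
          by linarith
        then have "?m = 0"
          by simp
        moreover have "norm (u t - v t) \<le> ?m"
          using \<open>a \<le> t\<close> by (intro max) auto
        ultimately show ?thesis
          by simp
      qed
    qed
  qed
  obtain n :: nat where "t / d \<le> real n"
    using real_arch_simple by blast
  then have "t \<le> real n * d"
    using d(1) by (simp add: field_simps)
  then show ?thesis
    using step t by blast
qed

text \<open>Banach's fixed point theorem on a closed ball of bounded continuous functions on the
  whole line; \<open>T\<close> is taken so small that the convolution term neither leaves the ball
  nor expands distances by more than 1/2.\<close>

lemma duhamel_fixed_point_exists:
  assumes N: "lipschitz_on_bounded_sets N"
    and f: "continuous_on {0..1} f"
  obtains T u where "0 < T" "continuous_on {0..T} u"
    "\<And>t. t \<in> {0..T} \<Longrightarrow> u t = f t + duhamel (\<lambda>s. N (u s)) t"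
proof -
  have "bounded (f ` {0..1})"
    using f by (intro compact_imp_bounded compact_continuous_image) auto
  then obtain R0 where R0: "0 < R0" and "\<forall>y\<in>f ` {0..1}. norm y \<le> R0"
    unfolding bounded_pos by blast
  then have f_bound: "norm (f t) \<le> R0" if "t \<in> {0..1}" for t
    using that by blast
  \<comment> \<open>The ball exceeds the bound of \<open>f\<close> by 1, room enough for a
    convolution term of norm at most 1/2.\<close>
  define R where "R = R0 + 1"
  have R: "0 < R"
    using R0 by (simp add: R_def)
  obtain L where L: "0 \<le> L" "L-lipschitz_on (cball 0 R) N"
    using lipschitz_on_bounded_setsE[OF N R] by blast
  define B where "B = norm (N 0) + L * R"
  have B0: "0 \<le> B"
    using L(1) R by (simp add: B_def)
  have B: "norm (N x) \<le> B" if "norm x \<le> R" for x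
  proof -
    have "norm (N x - N 0) \<le> L * norm x"
      using lipschitz_onD[OF L(2), of x 0] that R by (simp add: dist_norm)
    also have "\<dots> \<le> L * R"
      using that L(1) by (rule mult_left_mono)
    finally show ?thesis
      using norm_triangle_ineq2[of "N x" "N 0"] by (simp add: B_def)
  qed
  \<comment> \<open>One smallness condition serves twice: with factor \<open>B\<close>, a bound of
    \<open>N\<close> on the ball, for the self-map property, and with factor \<open>L\<close> for
    the contraction.\<close>
  obtain d where d: "0 < d" "mass d < 1 / (2 * (L + B + 1))"
    using mass_small[of "1 / (2 * (L + B + 1))"] L(1) B0 by auto
  \<comment> \<open>The cap 1 stays within the interval on which \<open>f\<close> is continuous and
    bounded by \<open>R0\<close>.\<close>
  define T where "T = min d 1"
  have T: "0 < T" "T \<le> 1"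
    using d(1) by (auto simp: T_def)
  have small: "c * mass t \<le> 1 / 2" if "0 \<le> c" "c \<le> L + B" "t \<le> T" for c t
  proof -
    have "mass t \<le> mass d"
      using that by (intro mass_mono) (auto simp: T_def)
    then have "c * mass t \<le> (L + B + 1) * (1 / (2 * (L + B + 1)))"
      using that d(2) mass_nonneg[of t] by (intro mult_mono) auto
    also have "\<dots> = 1 / 2"
      using L(1) B0 by simp
    finally show ?thesis .
  qed
  \<comment> \<open>Clamping time to \<open>{0..T}\<close> extends a function on this interval by
    its end values, which places the iteration in the complete space of bounded continuous functions
    on the line.\<close>
  define c where "c t = max 0 (min T t)" for t :: real
  have c: "c t \<in> {0..T}" for t
    using T by (auto simp: c_def)
  have c_id: "c t = t" if "t \<in> {0..T}" for t
    using that by (auto simp: c_def)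
  define F where "F w t = f t + duhamel (\<lambda>s. N (apply_bcontfun w s)) t"
    for w :: "real \<Rightarrow>\<^sub>C 'a" and t
  define X where "X = PiC UNIV (\<lambda>_::real. cball (0::'a) R)"
  have X: "w \<in> X \<longleftrightarrow> (\<forall>t. norm (apply_bcontfun w t) \<le> R)" for w
    by (auto simp: X_def mem_PiC_iff Pi_iff)
  have Nw: "continuous_on A (\<lambda>s. N (apply_bcontfun w s))" for w :: "real \<Rightarrow>\<^sub>C 'a" and A
    by (rule continuous_on_compose2[OF lipschitz_on_bounded_sets_imp_continuous_on[OF N, of UNIV]]) auto
  have F_cont: "continuous_on {0..T} (F w)" for w
    unfolding F_def using T
    by (intro continuous_intros continuous_on_duhamel Nw continuous_on_subset[OF f]) auto
  have F_bound: "norm (F w t) \<le> R" if "w \<in> X" "t \<in> {0..T}" for w t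
  proof -
    have "norm (duhamel (\<lambda>s. N (apply_bcontfun w s)) t) \<le> B * mass t"
      using that X B by (intro norm_duhamel_le Nw) auto
    also have "\<dots> \<le> 1 / 2"
      using that B0 L(1) by (intro small) auto
    finally show ?thesis
      using norm_triangle_ineq[of "f t" "duhamel (\<lambda>s. N (apply_bcontfun w s)) t"] f_bound[of t] that T
      by (simp add: F_def R_def)
  qed
  define \<Phi> where "\<Phi> w = Bcontfun (\<lambda>t. F w (c t))" for w
  have \<Phi>: "apply_bcontfun (\<Phi> w) t = F w (c t)" if "w \<in> X" for w t
  proof -
    have "continuous_on UNIV (\<lambda>t. F w (c t))"
      by (rule continuous_on_compose2[OF F_cont]) (use c in \<open>auto simp: c_def intro!: continuous_intros\<close>)
    \<comment> \<open>The abstraction \<open>Bcontfun\<close> is meaningful only for bounded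
      continuous functions; the bound comes from \<open>w \<in> X\<close>.\<close>
    then have "(\<lambda>t. F w (c t)) \<in> bcontfun"
      using F_bound[OF that c] by (rule bcontfun_normI)
    then show ?thesis
      by (simp add: \<Phi>_def Bcontfun_inverse)
  qed
  have "\<exists>!w\<in>X. \<Phi> w = w"
  proof (rule Banach_fix[where c="1 / 2"])
    show "complete X"
      unfolding X_def complete_eq_closed by (intro closed_PiC) auto
    have "const_bcontfun 0 \<in> X"
      using R by (simp add: X)
    then show "X \<noteq> {}"
      by blast
    show "\<Phi> ` X \<subseteq> X"
      using \<Phi> F_bound c by (auto simp: X)
    fix w z assume wz: "w \<in> X" "z \<in> X"
    show "dist (\<Phi> w) (\<Phi> z) \<le> 1 / 2 * dist w z"
    proof (rule dist_bound)
      fix t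
      have "dist (F w (c t)) (F z (c t)) = norm (duhamel (\<lambda>s. N (apply_bcontfun w s)) (c t)
          - duhamel (\<lambda>s. N (apply_bcontfun z s)) (c t))"
        by (simp add: F_def dist_norm)
      also have "\<dots> \<le> (L * dist w z) * mass (c t - 0)"
      proof (rule norm_duhamel_diff_le[OF _ _ Nw Nw])
        fix s
        have "norm (N (apply_bcontfun w s) - N (apply_bcontfun z s)) \<le> L * dist (apply_bcontfun w s) (apply_bcontfun z s)"
          using lipschitz_onD[OF L(2)] wz by (simp add: dist_norm X)
        also have "\<dots> \<le> L * dist w z"
          using L(1) by (intro mult_left_mono dist_bounded)
        finally show "norm (N (apply_bcontfun w s) - N (apply_bcontfun z s)) \<le> L * dist w z" .
      qed (use c in auto)
      also have "\<dots> = dist w z * (L * mass (c t))"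
        by simp
      also have "\<dots> \<le> dist w z * (1 / 2)"
        using L(1) B0 c[of t] by (intro mult_left_mono small) auto
      finally show "dist (apply_bcontfun (\<Phi> w) t) (apply_bcontfun (\<Phi> z) t) \<le> 1 / 2 * dist w z"
        using \<Phi> wz by simp
    qed
  qed auto
  then obtain w where w: "w \<in> X" "\<Phi> w = w"
    by blast
  show thesis
  proof (rule that[OF T(1)])
    show "continuous_on {0..T} (apply_bcontfun w)"
      by simp
    fix t assume "t \<in> {0..T}"
    \<comment> \<open>On \<open>{0..T}\<close> the clamp is the identity, so the fixed point
      satisfies the original equation there.\<close>
    then show "apply_bcontfun w t = f t + duhamel (\<lambda>s. N (apply_bcontfun w s)) t"
      using \<Phi>[OF w(1), of t] w(2) c_id by (simp add: F_def)
  qed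
qed

text \<open>Every existence interval contains \<open>{0..t}\<close> along with \<open>t\<close>, so
  the compact case applies with \<open>T = t\<close>, also when \<open>J1\<close> or
  \<open>J2\<close> is half-open or unbounded.\<close>

lemma mild_solutions_coincide:
  assumes N: "lipschitz_on_bounded_sets N"
    and u: "mild_solution S P N u0 J1 u" and v: "mild_solution S P N u0 J2 v"
    and t: "t \<in> J1 \<inter> J2"
  shows "u t = v t"
proof -
  have J: "0 \<le> t" "{0..t} \<subseteq> J1" "{0..t} \<subseteq> J2"
    using u v t existence_interval_Icc_subset unfolding mild_solution_def by blast+
  show ?thesis
  proof (rule duhamel_fixed_point_unique[OF N, where T=t and f="\<lambda>t. blinfun_apply (S t) u0"])
    show "continuous_on {0..t} u" "continuous_on {0..t} v"
      using u v J continuous_on_subset unfolding mild_solution_def by blast+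
  qed (use u v J in \<open>auto simp: mild_solution_iff_duhamel[OF N]\<close>)
qed

end

theorem theorem3p1:
  fixes S P :: "real \<Rightarrow> ('a::banach \<Rightarrow>\<^sub>L 'a)"
    and N :: "'a \<Rightarrow> 'a"
  assumes S_strongly_continuous: "\<And>x. continuous_on {0..} (\<lambda>t. blinfun_apply (S t) x)"
    and S_locally_bounded: "\<And>T. T > 0 \<Longrightarrow> bounded (S ` {0..T})"
    and S_zero: "S 0 = id_blinfun"
    and P_L1: "\<And>T. T > 0 \<Longrightarrow> bochner_integrable (lebesgue_on {0<..<T}) P"
    and N_lipschitz: "lipschitz_on_bounded_sets N"
  shows "(\<forall>u0. \<exists>T>0. \<exists>u. mild_solution S P N u0 {0..T} u \<and>
            (\<forall>v. mild_solution S P N u0 {0..T} v \<longrightarrow> (\<forall>t\<in>{0..T}. v t = u t))) \<and>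
         (\<forall>u0 J1 J2 u v. mild_solution S P N u0 J1 u \<longrightarrow> mild_solution S P N u0 J2 v \<longrightarrow>
            (\<forall>t\<in>J1 \<inter> J2. u t = v t))"
proof -
  interpret locally_L1_kernel P
    by standard (rule P_L1)
  have coincide: "\<forall>u0 J1 J2 u v. mild_solution S P N u0 J1 u \<longrightarrow> mild_solution S P N u0 J2 v \<longrightarrow>
      (\<forall>t\<in>J1 \<inter> J2. u t = v t)"
    using mild_solutions_coincide[OF N_lipschitz] by blast
  have "\<exists>T>0. \<exists>u. mild_solution S P N u0 {0..T} u" for u0
  proof -
    have "continuous_on {0..1} (\<lambda>t. blinfun_apply (S t) u0)"
      using S_strongly_continuous by (rule continuous_on_subset) auto
    then obtain T u where "0 < T" "continuous_on {0..T} u"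
      "\<And>t. t \<in> {0..T} \<Longrightarrow> u t = blinfun_apply (S t) u0 + duhamel (\<lambda>s. N (u s)) t"
      using duhamel_fixed_point_exists[OF N_lipschitz] by blast
    then show ?thesis
      unfolding mild_solution_iff_duhamel[OF N_lipschitz] existence_interval_def by blast
  qed
  \<comment> \<open>Uniqueness on \<open>{0..T}\<close> is coincidence with both intervals equal to
    \<open>{0..T}\<close>.\<close>
  then show ?thesis
    using coincide by (metis Int_absorb)
qed

end
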